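(* Let $n\geq 1$, and let $\phi$ be the involution on the set of transfer systems on $[n]\times[1]$ given by $\phi(\mathcal{R})=\big(({}^{\square}\mathcal{R})^{\mathrm{op}}\big)^\nabla$, where $\nabla$ is the duality $(i,j)\mapsto(n-i,1-j)$ on $[n]\times[1]$. Then for every $-1\leq k\leq n$, $\phi$ exchanges the sets $S_k$ and $S_{n-k-1}$.
   Context: $[n]$ is the poset $\{0<1<\dots<n\}$ and $[n]\times[1]$ has the product (coordinatewise) order. A poset $(\mathcal{P},\leq)$ is regarded as a category with a unique morphism $x\to y$ when $x\leq y$; a relation refining $\leq$ is identified with the corresponding collection of morphisms. A transfer system on $\mathcal{P}$ is a partial order $\mathcal{R}$ on $\mathcal{P}$ that refines $\leq$ (i.e. $x\,\mathcal{R}\,y$ implies $x\leq y$) and such that for all $x,y,z$, if $x\,\mathcal{R}\,y$, $z\leq y$, and $x\wedge z$ exists, then $(x\wedge z)\,\mathcal{R}\,z$. ${}^{\square}\mathcal{R}$ is the class of morphisms having the left lifting property with respect to all morphisms in $\mathcal{R}$: $a\to b$ is in ${}^{\square}\mathcal{R}$ iff for every $x\to y$ in $\mathcal{R}$ and every commutative square with left side $a\to b$, right side $x\to y$, top $a\to x$, bottom $b\to y$, there is a morphism $b\to x$ making both triangles commute. For a collection $\mathcal{M}$ of morphisms, $(\mathcal{M}^{\mathrm{op}})^\nabla=\{y^\nabla\to x^\nabla\mid (x\to y)\in\mathcal{M}\}$. For $0\leq k\leq n$, the $k$th slat in $[n]\times[1]$ is the relation $(k,0)\leq(k,1)$. If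 a transfer system $\mathcal{R}$ contains the $k$th slat, then it contains the $i$th slat for all $0\leq i<k$. The top slat of $\mathcal{R}$ is the slat with the largest $k$ such that $(k,0)\,\mathcal{R}\,(k,1)$. For $0\leq k\leq n$, $S_k$ is the set of transfer systems on $[n]\times[1]$ whose top slat is the $k$th slat, and $S_{-1}$ is the set of transfer systems with no slats. *)

theory Defs
  imports Main "HOL-Library.Product_Order"
begin

text \<open>
  A poset is a subset \<open>P\<close> of a type of class \<open>order\<close>, with the induced order. Viewed as a
  category, it has exactly one morphism \<open>x \<rightarrow> y\<close> for each \<open>x \<le> y\<close> in \<open>P\<close>, so a morphism is the
  pair \<open>(x, y)\<close> and a collection of morphisms is a relation contained in the order.
\<close>

text \<open>Meets are taken inside \<open>P\<close> and need not exist, so being a meet is a predicate.\<close>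

definition is_meet :: "'a::order set \<Rightarrow> 'a \<Rightarrow> 'a \<Rightarrow> 'a \<Rightarrow> bool" where
  "is_meet P x z m \<longleftrightarrow>
     m \<in> P \<and> m \<le> x \<and> m \<le> z \<and> (\<forall>w\<in>P. w \<le> x \<and> w \<le> z \<longrightarrow> w \<le> m)"

definition transfer_system :: "'a::order set \<Rightarrow> 'a rel \<Rightarrow> bool" where
  "transfer_system P R \<longleftrightarrow>
     partial_order_on P R \<and>
     (\<forall>x y. (x, y) \<in> R \<longrightarrow> x \<le> y) \<and>
     (\<forall>x y z m. (x, y) \<in> R \<longrightarrow> z \<in> P \<longrightarrow> z \<le> y \<longrightarrow> is_meet P x z m \<longrightarrow> (m, z) \<in> R)"

text \<open>
  The square with left side \<open>a \<rightarrow> b\<close> and right side \<open>x \<rightarrow> y\<close> exists iff \<open>a \<le> x\<close> and \<open>b \<le> y\<close>; since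
  parallel morphisms of a poset are equal, it then commutes, and any morphism \<open>b \<rightarrow> x\<close> makes both
  triangles commute.
\<close>

definition has_lift :: "'a::order \<times> 'a \<Rightarrow> 'a \<times> 'a \<Rightarrow> bool" where
  "has_lift f g \<longleftrightarrow> (fst f \<le> fst g \<and> snd f \<le> snd g \<longrightarrow> snd f \<le> fst g)"

definition left_lifting :: "'a::order set \<Rightarrow> 'a rel \<Rightarrow> 'a rel" where
  "left_lifting P R = {(a, b). a \<in> P \<and> b \<in> P \<and> a \<le> b \<and> (\<forall>g\<in>R. has_lift (a, b) g)}"

definition op_dual :: "('a \<Rightarrow> 'a) \<Rightarrow> 'a rel \<Rightarrow> 'a rel" where
  "op_dual d M = {(d y, d x) | x y. (x, y) \<in> M}"

text \<open>The order on \<open>nat \<times> nat\<close> is the coordinatewise one from \<^theory>\<open>HOL-Library.Product_Order\<close>.\<close>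

definition grid :: "nat \<Rightarrow> (nat \<times> nat) set" where
  "grid n = {0..n} \<times> {0..1}"

text \<open>Only used on \<open>grid n\<close>, where the subtractions do not truncate.\<close>

definition nabla :: "nat \<Rightarrow> nat \<times> nat \<Rightarrow> nat \<times> nat" where
  "nabla n = (\<lambda>(i, j). (n - i, 1 - j))"

definition phi :: "nat \<Rightarrow> (nat \<times> nat) rel \<Rightarrow> (nat \<times> nat) rel" where
  "phi n R = op_dual (nabla n) (left_lifting (grid n) R)"

definition slat :: "nat \<Rightarrow> (nat \<times> nat) \<times> (nat \<times> nat)" where
  "slat k = ((k, 0), (k, 1))"

definition is_top_slat :: "nat \<Rightarrow> (nat \<times> nat) rel \<Rightarrow> nat \<Rightarrow> bool" where
  "is_top_slat n R k \<longleftrightarrow> k \<le> n \<and> slat k \<in> R \<and> (\<forall>i\<le>n. slat i \<in> R \<longrightarrow> i \<le> k)"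

text \<open>
  The set $S_k$, for an integer index \<open>k\<close> because of $S_{-1}$; it is empty unless \<open>- 1 \<le> k \<le> n\<close>.
\<close>

definition slat_class :: "nat \<Rightarrow> int \<Rightarrow> (nat \<times> nat) rel set" where
  "slat_class n k = {R. transfer_system (grid n) R \<and>
     ((k = - 1 \<and> (\<forall>i\<le>n. slat i \<notin> R)) \<or> (\<exists>m. k = int m \<and> is_top_slat n R m))}"

definition involution_on :: "'b set \<Rightarrow> ('b \<Rightarrow> 'b) \<Rightarrow> bool" where
  "involution_on A f \<longleftrightarrow> (\<forall>x\<in>A. f x \<in> A \<and> f (f x) = x)"

end

theory Submission imports Defs begin

text \<open>
  For a transfer system \<open>R\<close> on a finite poset with meets, every \<open>x \<le> y\<close> factors as a map \<open>x \<rightarrow> m\<close> with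
  the left lifting property followed by a map \<open>m \<rightarrow> y\<close> in \<open>R\<close>: take \<open>m\<close> minimal above \<open>x\<close> with
  \<open>(m, y) \<in> R\<close>. The retract argument then gives that \<open>R\<close> consists of all maps with the right lifting
  property against \<open>left_lifting P R\<close>, and an order-reversing involution turns this into the involutivity of
  \<open>\<phi>\<close>. On the grid, a slat has the left lifting property against \<open>R\<close> iff it is not in \<open>R\<close>, because
  a map of \<open>R\<close> obstructing the lift restricts to that slat. Hence \<open>\<phi> R\<close> contains the \<open>i\<close>th slat iff
  \<open>R\<close> does not contain the \<open>(n - i)\<close>th.
\<close>

section \<open>Transfer systems as right lifting classes\<close>

lemma transfer_systemD:
  assumes "transfer_system P R"
  shows transfer_system_mem: "(x, y) \<in> R \<Longrightarrow> x \<in> P \<and> y \<in> P"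
    and transfer_system_refl: "x \<in> P \<Longrightarrow> (x, x) \<in> R"
    and transfer_system_trans: "(x, y) \<in> R \<Longrightarrow> (y, z) \<in> R \<Longrightarrow> (x, z) \<in> R"
    and transfer_system_le: "(x, y) \<in> R \<Longrightarrow> x \<le> y"
    and transfer_system_restrict:
      "(x, y) \<in> R \<Longrightarrow> z \<in> P \<Longrightarrow> z \<le> y \<Longrightarrow> is_meet P x z m \<Longrightarrow> (m, z) \<in> R"
  using assms unfolding transfer_system_def partial_order_on_def preorder_on_def
  by (blast dest: refl_onD transD)+

lemma left_lifting_iff:
  "(a, b) \<in> left_lifting P R \<longleftrightarrow>
    a \<in> P \<and> b \<in> P \<and> a \<le> b \<and> (\<forall>x y. (x, y) \<in> R \<longrightarrow> a \<le> x \<longrightarrow> b \<le> y \<longrightarrow> b \<le> x)"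
  unfolding left_lifting_def has_lift_def by auto

text \<open>Restricting a map \<open>u \<rightarrow> v\<close> of \<open>R\<close> along
  \<open>m \<le> v\<close> gives a map of \<open>R\<close> from the meet of \<open>u\<close> and
  \<open>m\<close> to \<open>m\<close>. Composed with \<open>m \<rightarrow> y\<close>, it makes
  that meet a competitor of the minimal \<open>m\<close>, so \<open>m \<le> u\<close>.\<close>

lemma transfer_system_factorization:
  assumes R: "transfer_system P R" and fin: "finite P"
    and meets: "\<And>x z. x \<in> P \<Longrightarrow> z \<in> P \<Longrightarrow> \<exists>m. is_meet P x z m"
    and xy: "x \<in> P" "y \<in> P" "x \<le> y"
  obtains m where "(x, m) \<in> left_lifting P R" "(m, y) \<in> R"
proof -
  let ?A = "{z \<in> P. x \<le> z \<and> (z, y) \<in> R}"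
  have "y \<in> ?A"
    using xy transfer_system_refl[OF R] by simp
  then obtain m where m: "m \<in> ?A" and minimal: "\<And>z. z \<in> ?A \<Longrightarrow> z \<le> m \<Longrightarrow> m = z"
    using finite_has_minimal[of ?A] fin by auto
  have "m \<le> u" if uv: "(u, v) \<in> R" and "x \<le> u" "m \<le> v" for u v
  proof -
    obtain w where w: "is_meet P u m w"
      using meets transfer_system_mem[OF R uv] m by blast
    have "(w, m) \<in> R"
      using transfer_system_restrict[OF R uv _ \<open>m \<le> v\<close> w] m by blast
    then have "(w, y) \<in> R"
      using transfer_system_trans[OF R] m by blast
    then have "w \<in> ?A"
      using w m xy \<open>x \<le> u\<close> by (simp add: is_meet_def)
    with minimal w show "m \<le> u"
      unfolding is_meet_def by blast
  qed
  then have "(x, m) \<in> left_lifting P R"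
    using m xy by (simp add: left_lifting_iff)
  with m show thesis
    by (blast intro: that)
qed

lemma transfer_system_eq_right_lifting:
  assumes R: "transfer_system P R" and "finite P"
    and "\<And>x z. x \<in> P \<Longrightarrow> z \<in> P \<Longrightarrow> \<exists>m. is_meet P x z m"
  shows "(x, y) \<in> R \<longleftrightarrow> x \<in> P \<and> y \<in> P \<and> x \<le> y \<and>
    (\<forall>a b. (a, b) \<in> left_lifting P R \<longrightarrow> a \<le> x \<longrightarrow> b \<le> y \<longrightarrow> b \<le> x)"
    (is "_ \<longleftrightarrow> ?rlp")
proof
  assume "(x, y) \<in> R"
  then show ?rlp
    using transfer_system_mem[OF R] transfer_system_le[OF R] by (auto simp: left_lifting_iff)
next
  assume rlp: ?rlp
  then obtain m where m: "(x, m) \<in> left_lifting P R" "(m, y) \<in> R"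
    using transfer_system_factorization[OF assms] by metis
  \<comment> \<open>The assumed lifting property is applied to the left factor
    \<open>x \<rightarrow> m\<close> itself, in the square over \<open>x \<rightarrow> y\<close>;
    the lift is \<open>m \<le> x\<close>.\<close>
  then have "m = x"
    using rlp transfer_system_le[OF R] by (meson antisym left_lifting_iff order_refl)
  with m show "(x, y) \<in> R" by simp
qed

section \<open>Order-reversing involutions and the operation \<open>op_dual\<close>\<close>

locale poset_duality =
  fixes P :: "'a::order set" and d :: "'a \<Rightarrow> 'a"
  assumes dual_mem: "x \<in> P \<Longrightarrow> d x \<in> P"
    and dual_dual: "x \<in> P \<Longrightarrow> d (d x) = x"
    and dual_antimono: "x \<in> P \<Longrightarrow> y \<in> P \<Longrightarrow> x \<le> y \<Longrightarrow> d y \<le> d x"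
begin

lemma dual_le_iff: "x \<in> P \<Longrightarrow> y \<in> P \<Longrightarrow> d x \<le> d y \<longleftrightarrow> y \<le> x"
  by (metis dual_mem dual_dual dual_antimono)

lemma op_dual_iff:
  assumes "M \<subseteq> P \<times> P"
  shows "(x, y) \<in> op_dual d M \<longleftrightarrow> x \<in> P \<and> y \<in> P \<and> (d y, d x) \<in> M"
proof
  assume "(x, y) \<in> op_dual d M"
  then obtain a b where "x = d b" "y = d a" "(a, b) \<in> M"
    unfolding op_dual_def by auto
  with assms show "x \<in> P \<and> y \<in> P \<and> (d y, d x) \<in> M"
    by (auto simp: dual_dual dual_mem)
next
  assume "x \<in> P \<and> y \<in> P \<and> (d y, d x) \<in> M"
  then show "(x, y) \<in> op_dual d M"
    unfolding op_dual_def by (force simp: dual_dual)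
qed

lemma left_lifting_subset: "left_lifting P R \<subseteq> P \<times> P"
  unfolding left_lifting_def by auto

lemmas op_dual_left_lifting_iff = op_dual_iff[OF left_lifting_subset]

text \<open>Left lifting classes are closed under composition and pushout. Duality turns the meet
  \<open>m\<close> into the join of \<open>d x\<close> and \<open>d z\<close>, so restriction
  becomes the pushout of \<open>d y \<rightarrow> d x\<close> along
  \<open>d y \<le> d z\<close>.\<close>

lemma transfer_system_op_dual_left_lifting:
  assumes R: "transfer_system P R"
  shows "transfer_system P (op_dual d (left_lifting P R))"
proof -
  let ?D = "op_dual d (left_lifting P R)"
  have le: "x \<le> y" if "(x, y) \<in> ?D" for x y
    using that dual_le_iff by (auto simp: op_dual_left_lifting_iff left_lifting_iff)
  have "refl_on P ?D"
    by (rule refl_onI) (auto simp: op_dual_left_lifting_iff left_lifting_iff dual_mem)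
  moreover have "trans ?D"
  proof (rule transI)
    fix x y z
    assume "(x, y) \<in> ?D" "(y, z) \<in> ?D"
    then show "(x, z) \<in> ?D"
      unfolding op_dual_left_lifting_iff left_lifting_iff by (meson order_trans)
  qed
  moreover have "antisym ?D"
    using le by (auto intro: antisymI order_antisym)
  moreover have "?D \<subseteq> P \<times> P"
    by (auto simp: op_dual_left_lifting_iff)
  moreover have "(m, z) \<in> ?D"
    if xy: "(x, y) \<in> ?D" and z: "z \<in> P" "z \<le> y" and m: "is_meet P x z m" for x y z m
  proof -
    have P: "x \<in> P" "y \<in> P" "m \<in> P" "m \<le> z" "m \<le> x"
      using xy m by (auto simp: op_dual_left_lifting_iff is_meet_def)
    have "d m \<le> u" if uv: "(u, v) \<in> R" and u: "d z \<le> u" and v: "d m \<le> v" for u v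
    proof -
      have uP: "u \<in> P"
        using transfer_system_mem[OF R uv] by simp
      have "d y \<le> u" "d x \<le> v"
        using u v P z by (auto intro: order_trans dual_antimono)
      then have "d x \<le> u"
        using xy uv by (auto simp: op_dual_left_lifting_iff left_lifting_iff)
      \<comment> \<open>The universal property of the join \<open>d m\<close> is that of the meet
        \<open>m\<close>, read through \<open>d\<close>.\<close>
      then have "d u \<le> x" "d u \<le> z"
        using u uP P z by (metis dual_antimono dual_dual dual_mem)+
      then have "d u \<le> m"
        using m dual_mem[OF uP] by (simp add: is_meet_def)
      then show "d m \<le> u"
        using uP P by (metis dual_antimono dual_dual dual_mem)
    qed
    then show ?thesis
      using P z by (auto simp: op_dual_left_lifting_iff left_lifting_iff dual_mem dual_antimono)
  qed
  ultimately show ?thesis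
    using le unfolding transfer_system_def partial_order_on_def preorder_on_def by blast
qed

text \<open>Dualizing turns left lifting against \<open>op_dual d ?L\<close> into right lifting
  against \<open>?L\<close>, which characterizes \<open>R\<close>.\<close>

lemma op_dual_left_lifting_involutive:
  assumes R: "transfer_system P R" and "finite P"
    and "\<And>x z. x \<in> P \<Longrightarrow> z \<in> P \<Longrightarrow> \<exists>m. is_meet P x z m"
  shows "op_dual d (left_lifting P (op_dual d (left_lifting P R))) = R"
proof -
  let ?L = "left_lifting P R"
  have "(x, y) \<in> op_dual d (left_lifting P (op_dual d ?L)) \<longleftrightarrow> (x, y) \<in> R" for x y
  proof (cases "x \<in> P \<and> y \<in> P")
    case True
    have "(\<forall>u v. (u, v) \<in> op_dual d ?L \<longrightarrow> d y \<le> u \<longrightarrow> d x \<le> v \<longrightarrow> d x \<le> u) \<longleftrightarrow>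
        (\<forall>a b. (a, b) \<in> ?L \<longrightarrow> d y \<le> d b \<longrightarrow> d x \<le> d a \<longrightarrow> d x \<le> d b)"
      unfolding op_dual_def by blast
    also have "\<dots> \<longleftrightarrow> (\<forall>a b. (a, b) \<in> ?L \<longrightarrow> a \<le> x \<longrightarrow> b \<le> y \<longrightarrow> b \<le> x)"
      using True left_lifting_subset by (auto simp: dual_le_iff left_lifting_iff)
    finally show ?thesis
      using True transfer_system_eq_right_lifting[OF assms, of x y]
      by (simp add: op_dual_left_lifting_iff left_lifting_iff[of "d y"] dual_mem dual_le_iff)
  next
    case False
    then show ?thesis
      using transfer_system_mem[OF R] by (auto simp: op_dual_left_lifting_iff)
  qed
  then show ?thesis by auto
qed

end

section \<open>The grid and its slats\<close>

lemma mem_grid_iff: "(i, j) \<in> grid n \<longleftrightarrow> i \<le> n \<and> j \<le> 1"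
  by (auto simp: grid_def)

interpretation grid: poset_duality "grid n" "nabla n" for n
  by unfold_locales (auto simp: grid_def nabla_def)

lemma is_meet_grid:
  assumes "x \<in> grid n" "z \<in> grid n"
  shows "is_meet (grid n) x z (inf x z)"
  using assms by (auto simp: is_meet_def grid_def inf_prod_def le_infI1)

lemma transfer_system_phi:
  "transfer_system (grid n) R \<Longrightarrow> transfer_system (grid n) (phi n R)"
  unfolding phi_def by (rule grid.transfer_system_op_dual_left_lifting)

lemma phi_phi:
  assumes "transfer_system (grid n) R"
  shows "phi n (phi n R) = R"
  unfolding phi_def
proof (rule grid.op_dual_left_lifting_involutive[OF assms])
  show "finite (grid n)" by (simp add: grid_def)
qed (use is_meet_grid in blast)

text \<open>The map is restricted along \<open>(j, 1) \<le> (b, 1)\<close>, valid since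
  \<open>j \<le> a \<le> b\<close>. The case \<open>a = b\<close> says that slats are downward
  closed.\<close>

lemma slat_below:
  assumes R: "transfer_system (grid n) R" and ab: "((a, 0), (b, 1)) \<in> R" and "j \<le> a"
  shows "slat j \<in> R"
proof -
  have P: "(a, 0) \<in> grid n" "(j, 1) \<in> grid n" "(j, 1::nat) \<le> (b, 1)"
    using transfer_system_mem[OF R ab] transfer_system_le[OF R ab] \<open>j \<le> a\<close>
    by (auto simp: mem_grid_iff)
  have "is_meet (grid n) (a, 0) (j, 1) (j, 0)"
    using is_meet_grid[OF P(1,2)] \<open>j \<le> a\<close> by (simp add: inf_absorb2 inf_nat_def)
  then show ?thesis
    using transfer_system_restrict[OF R ab P(2,3)] by (simp add: slat_def)
qed

lemma slat_left_lifting_iff: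
  assumes R: "transfer_system (grid n) R" and "j \<le> n"
  shows "slat j \<in> left_lifting (grid n) R \<longleftrightarrow> slat j \<notin> R"
proof
  assume "slat j \<in> left_lifting (grid n) R"
  then show "slat j \<notin> R"
    by (force simp: slat_def left_lifting_iff)
next
  assume nR: "slat j \<notin> R"
  have "(j, 1) \<le> x" if xy: "(x, y) \<in> R" and le: "(j, 0) \<le> x" "(j, 1) \<le> y" for x y
  proof (rule ccontr)
    assume nle: "\<not> (j, 1) \<le> x"
    obtain a c b e where [simp]: "x = (a, c)" "y = (b, e)" by fastforce
    \<comment> \<open>The square forces \<open>j \<le> a\<close> and \<open>e = 1\<close>, so a
      missing lift can only come from the second coordinate of \<open>x\<close>.\<close>
    have "c = 0" "e = 1" "j \<le> a"
      using transfer_system_mem[OF R xy] le nle by (auto simp: mem_grid_iff)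
    with slat_below[OF R] xy nR show False by simp
  qed
  then show "slat j \<in> left_lifting (grid n) R"
    using \<open>j \<le> n\<close> by (auto simp: slat_def left_lifting_iff mem_grid_iff)
qed

text \<open>\<open>nabla n\<close> swaps the ends of a slat and \<open>op_dual\<close> swaps them
  back, so slat \<open>i\<close> corresponds to slat \<open>n - i\<close>.\<close>

lemma slat_phi_iff:
  assumes "transfer_system (grid n) R" "i \<le> n"
  shows "slat i \<in> phi n R \<longleftrightarrow> slat (n - i) \<notin> R"
proof -
  have "slat i \<in> phi n R \<longleftrightarrow> slat (n - i) \<in> left_lifting (grid n) R"
    using \<open>i \<le> n\<close>
    unfolding phi_def slat_def grid.op_dual_left_lifting_iff
    by (simp add: mem_grid_iff nabla_def)
  with slat_left_lifting_iff[OF assms(1)] show ?thesis by simp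
qed

text \<open>By downward closure the slats of \<open>R\<close> form an initial segment; comparing
  integers treats \<open>k = - 1\<close> uniformly with the other indices.\<close>

lemma slat_class_iff:
  assumes "- 1 \<le> k" "k \<le> int n"
  shows "R \<in> slat_class n k \<longleftrightarrow>
    transfer_system (grid n) R \<and> (\<forall>i\<le>n. slat i \<in> R \<longleftrightarrow> int i \<le> k)"
proof (cases "transfer_system (grid n) R")
  case R: True
  have down: "slat i \<in> R" if "slat m \<in> R" "i \<le> m" for i m
    using slat_below[OF R] that by (simp add: slat_def)
  show ?thesis
  proof (cases "k = - 1")
    case True
    then show ?thesis using R by (auto simp: slat_class_def)
  next
    case False
    with assms have "0 \<le> k" by simp
    then obtain m where [simp]: "k = int m"
      using nonneg_int_cases by blast
    have "m \<le> n" using assms by simp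
    then show ?thesis using R down by (auto simp: slat_class_def is_top_slat_def)
  qed
qed (simp add: slat_class_def)

lemma phi_slat_class:
  assumes k: "- 1 \<le> k" "k \<le> int n" and R: "R \<in> slat_class n k"
  shows "phi n R \<in> slat_class n (int n - k - 1)"
proof -
  have k': "- 1 \<le> int n - k - 1" "int n - k - 1 \<le> int n"
    using k by auto
  show ?thesis
    \<comment> \<open>For \<open>i \<le> n\<close>, the negation of \<open>n - i \<le> k\<close> is
      \<open>i \<le> n - k - 1\<close> over the integers.\<close>
    using R unfolding slat_class_iff[OF k] slat_class_iff[OF k']
    by (auto simp: transfer_system_phi slat_phi_iff of_nat_diff)
qed

lemma phi_image_slat_class:
  assumes k: "- 1 \<le> k" "k \<le> int n"
  shows "phi n ` slat_class n k = slat_class n (int n - k - 1)"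
proof
  show "phi n ` slat_class n k \<subseteq> slat_class n (int n - k - 1)"
    using phi_slat_class[OF k] by blast
next
  show "slat_class n (int n - k - 1) \<subseteq> phi n ` slat_class n k"
  proof
    fix R
    assume R: "R \<in> slat_class n (int n - k - 1)"
    \<comment> \<open>The index map \<open>k \<mapsto> n - k - 1\<close> is its own inverse, so
      \<open>phi n R\<close> serves as the preimage of \<open>R\<close>.\<close>
    then have "phi n R \<in> slat_class n k"
      using phi_slat_class[of "int n - k - 1" n R] k by simp
    moreover have "R = phi n (phi n R)"
      using R phi_phi by (simp add: slat_class_def)
    ultimately show "R \<in> phi n ` slat_class n k" by blast
  qed
qed

theorem proposition4p24:
  fixes n :: nat
  assumes "n \<ge> 1"
  shows "involution_on {R. transfer_system (grid n) R} (phi n) \<and>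
    (\<forall>k::int. - 1 \<le> k \<and> k \<le> int n \<longrightarrow>
       phi n ` slat_class n k = slat_class n (int n - k - 1) \<and>
       phi n ` slat_class n (int n - k - 1) = slat_class n k)"
proof (intro conjI allI impI)
  show "involution_on {R. transfer_system (grid n) R} (phi n)"
    by (simp add: involution_on_def transfer_system_phi phi_phi)
next
  fix k :: int
  assume k: "- 1 \<le> k \<and> k \<le> int n"
  then show "phi n ` slat_class n k = slat_class n (int n - k - 1)"
    by (simp add: phi_image_slat_class)
  show "phi n ` slat_class n (int n - k - 1) = slat_class n k"
    using phi_image_slat_class[of "int n - k - 1" n] k by simp
qed

end
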